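(* Let $\boldsymbol{n}=(1,2,3,\ldots)$ be the sequence of positive integers and let $\boldsymbol{q}=(q_n)_{n=1}^\infty=(1,2,1,3,1,2,1,4,\ldots)$ be the sequence where $q_n$ is the 2-adic valuation of $2n$. Then $\alpha(\boldsymbol{n})=\boldsymbol{q}$, where $\alpha$ is the recursive transform defined in the context.
   Context: For a sequence $\boldsymbol{a}=(a_n)_{n=1}^\infty$ of integers, $\alpha(\boldsymbol{a})=\boldsymbol{b}=(b_n)_{n=1}^\infty$ is recursively defined by: (1) $b_1=a_1$, $b_2=a_2$; (2) for any $i\ge2$, let $j$ be the first index such that $b_j=a_i$; then $b_{j+k}=b_k$ for $k=1,2,\ldots,j-1$, and $b_{2j}=a_{i+1}$. Thus $\boldsymbol{b}=(a_1,a_2,a_1,a_3,a_1,a_2,a_1,a_4,\ldots)$; equivalently $b_{2^{t-1}(2k-1)}=a_t$ for all $t,k\ge1$. *)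

theory Defs
  imports "HOL-Library.FuncSet" "HOL-Computational_Algebra.Primes"
begin

text \<open>Integer sequences indexed from 1 are the extensional functions on \<open>{1..}\<close>;
  the value at 0 carries no information, and equality is termwise equality from index 1 on.\<close>

definition int_seqs :: "(nat \<Rightarrow> int) set" where
  "int_seqs = {1..} \<rightarrow>\<^sub>E UNIV"

definition is_alpha :: "(nat \<Rightarrow> int) \<Rightarrow> (nat \<Rightarrow> int) \<Rightarrow> bool" where
  "is_alpha a b \<longleftrightarrow>
     b 1 = a 1 \<and> b 2 = a 2 \<and>
     (\<forall>i\<ge>2. \<exists>j\<ge>1. b j = a i \<and> (\<forall>m\<in>{1..<j}. b m \<noteq> a i) \<and>
        (\<forall>k\<in>{1..j - 1}. b (j + k) = b k) \<and> b (2 * j) = a (i + 1))"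

text \<open>The recursion determines \<open>b\<close> when the terms of \<open>a\<close> are pairwise distinct. For
  sequences with repeated terms the clauses, read literally, may have no solution or several,
  and then \<open>alpha a\<close> is unspecified.\<close>

definition alpha :: "(nat \<Rightarrow> int) \<Rightarrow> (nat \<Rightarrow> int)" where
  "alpha a = (THE b. b \<in> int_seqs \<and> is_alpha a b)"

definition n_seq :: "nat \<Rightarrow> int" where
  "n_seq = (\<lambda>n\<in>{1..}. int n)"

definition q_seq :: "nat \<Rightarrow> int" where
  "q_seq = (\<lambda>n\<in>{1..}. int (multiplicity 2 (2 * n)))"

end

theory Submission
  imports Defs
begin

text \<open>Read on the block of indices up to \<open>2 ^ n\<close>, the sequence \<open>q\<close> attains the value \<open>n + 1\<close> for the
  first time at \<open>2 ^ n\<close>, and adding \<open>2 ^ n\<close> to a smaller positive index does not change its 2-adic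
  valuation; so \<open>q\<close> obeys the recursion. Conversely, if a solution agrees with \<open>q\<close> up to \<open>2 ^ n\<close>,
  the first occurrence of \<open>n + 1\<close> is forced to be \<open>2 ^ n\<close>, and the recursion extends the agreement
  up to \<open>2 ^ (n + 1)\<close>.\<close>

lemma multiplicity_two_less:
  fixes m n :: nat
  assumes "1 \<le> m" "m < 2 ^ n"
  shows "multiplicity 2 m < n"
proof (rule multiplicity_lessI)
  show "\<not> 2 ^ n dvd m"
    using assms by (auto dest: dvd_imp_le)
qed (use assms in auto)

text \<open>With \<open>v\<close> the valuation of \<open>k\<close>, \<open>v < n\<close> makes
  \<open>2 ^ Suc v\<close> divide \<open>2 ^ n\<close> but not \<open>k\<close>, hence not the
  sum.\<close>

lemma multiplicity_two_power_add:
  fixes k n :: nat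
  assumes "1 \<le> k" "k < 2 ^ n"
  shows "multiplicity 2 (2 ^ n + k) = multiplicity 2 k"
proof (rule multiplicity_eqI)
  let ?v = "multiplicity 2 k"
  have v: "?v < n"
    using assms by (rule multiplicity_two_less)
  then show "2 ^ ?v dvd 2 ^ n + k"
    by (intro dvd_add le_imp_power_dvd multiplicity_dvd) simp
  have "\<not> 2 ^ Suc ?v dvd k"
    using assms by (simp add: power_dvd_iff_le_multiplicity del: power_Suc)
  moreover have "2 ^ Suc ?v dvd (2 ^ n :: nat)"
    using v by (intro le_imp_power_dvd) simp
  ultimately show "\<not> 2 ^ Suc ?v dvd 2 ^ n + k"
    by (simp add: dvd_add_right_iff del: power_Suc)
qed

lemma q_seq_eq: "1 \<le> m \<Longrightarrow> q_seq m = int (Suc (multiplicity 2 m))"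
  by (simp add: q_seq_def multiplicity_times_same)

lemma q_seq_power: "q_seq (2 ^ n) = int (Suc n)"
  by (simp add: q_seq_eq)

lemma q_seq_less: "1 \<le> m \<Longrightarrow> m < 2 ^ n \<Longrightarrow> q_seq m < int (Suc n)"
  using multiplicity_two_less[of m n] by (simp add: q_seq_eq)

lemma q_seq_power_add: "1 \<le> k \<Longrightarrow> k < 2 ^ n \<Longrightarrow> q_seq (2 ^ n + k) = q_seq k"
  using multiplicity_two_power_add[of k n] by (simp add: q_seq_eq)

lemma n_seq_eq: "1 \<le> i \<Longrightarrow> n_seq i = int i"
  by (simp add: n_seq_def)

lemma is_alpha_q_seq: "is_alpha n_seq q_seq"
  unfolding is_alpha_def
proof (intro conjI allI impI)
  show "q_seq 1 = n_seq 1"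
    using q_seq_power[of 0] by (simp add: n_seq_eq)
  show "q_seq 2 = n_seq 2"
    using q_seq_power[of 1] by (simp add: n_seq_eq)
next
  fix i :: nat
  assume "2 \<le> i"
  then obtain n where i: "i = Suc n"
    by (cases i) auto
  show "\<exists>j\<ge>1. q_seq j = n_seq i \<and> (\<forall>m\<in>{1..<j}. q_seq m \<noteq> n_seq i) \<and>
          (\<forall>k\<in>{1..j - 1}. q_seq (j + k) = q_seq k) \<and> q_seq (2 * j) = n_seq (i + 1)"
  \<comment> \<open>Since \<open>i = Suc n\<close>, the value \<open>i\<close> first occurs at
    \<open>2 ^ n\<close>.\<close>
  proof (intro exI[of _ "2 ^ n"] conjI ballI)
    show "q_seq m \<noteq> n_seq i" if "m \<in> {1..<2 ^ n}" for m
      using q_seq_less[of m n] that by (simp add: i n_seq_eq)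
    show "q_seq (2 ^ n + k) = q_seq k" if "k \<in> {1..2 ^ n - 1}" for k
      using that by (intro q_seq_power_add) auto
    show "q_seq (2 * 2 ^ n) = n_seq (i + 1)"
      using q_seq_power[of "Suc n"] by (simp add: i n_seq_eq)
  qed (simp_all add: i n_seq_eq q_seq_power)
qed

text \<open>The blocks start at length 2 because the recursion only speaks of
  \<open>i \<ge> 2\<close>: the two initial values settle the first block, and the clause for
  \<open>i = Suc N\<close> doubles the block of length \<open>2 ^ N\<close>.\<close>

lemma is_alpha_n_seq_unique:
  assumes b: "is_alpha n_seq b"
  shows "\<forall>m\<in>{1..2 ^ Suc n}. b m = q_seq m"
proof (induction n)
  case 0
  have "{1..2 ^ Suc 0} = {1, 2 :: nat}"
    by auto
  then show ?case
    using b is_alpha_q_seq by (simp add: is_alpha_def)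
next
  case (Suc n)
  define N where "N = Suc n"
  have IH: "b m = q_seq m" if "1 \<le> m" "m \<le> 2 ^ N" for m
    using Suc that by (simp add: N_def)
  have "2 \<le> Suc N"
    by (simp add: N_def)
  with b obtain j where j: "1 \<le> j" "b j = n_seq (Suc N)" "\<forall>m\<in>{1..<j}. b m \<noteq> n_seq (Suc N)"
    "\<forall>k\<in>{1..j - 1}. b (j + k) = b k" "b (2 * j) = n_seq (Suc N + 1)"
    unfolding is_alpha_def by blast
  have "b (2 ^ N) = n_seq (Suc N)"
    by (simp add: IH q_seq_power n_seq_eq)
  then have "j \<le> 2 ^ N"
    using j(3) by (meson atLeastLessThan_iff not_le one_le_power one_le_numeral)
  \<comment> \<open>An earlier \<open>j\<close> would lie where \<open>b\<close> agrees with
    \<open>q_seq\<close>, whose values before \<open>2 ^ N\<close> are all below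
    \<open>Suc N\<close>.\<close>
  moreover have "\<not> j < 2 ^ N"
    using j(1,2) IH[of j] q_seq_less[of j N] by (auto simp: n_seq_eq)
  ultimately have j_eq: "j = 2 ^ N"
    by simp
  have "b m = q_seq m" if m: "1 \<le> m" "m \<le> 2 ^ Suc N" for m
  proof -
    \<comment> \<open>The known block, its copy under the shift by \<open>j\<close>, and the new
      value at \<open>2 * j\<close>.\<close>
    consider "m \<le> 2 ^ N" | "2 ^ N < m" "m < 2 ^ Suc N" | "m = 2 ^ Suc N"
      using m by linarith
    then show ?thesis
    proof cases
      case 1
      then show ?thesis
        using IH m by simp
    next
      case 2
      define k where "k = m - 2 ^ N"
      have k: "m = 2 ^ N + k" "1 \<le> k" "k < 2 ^ N"
        using 2 by (auto simp: k_def)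
      have "b m = b k"
        using j(4) k by (simp add: j_eq)
      also have "\<dots> = q_seq k"
        using k by (simp add: IH)
      also have "\<dots> = q_seq m"
        using k q_seq_power_add by simp
      finally show ?thesis .
    next
      case 3
      then show ?thesis
        using j(5) q_seq_power[of "Suc N"] by (simp add: j_eq n_seq_eq)
    qed
  qed
  then show ?case
    by (simp add: N_def)
qed

theorem corollary3: "alpha n_seq = q_seq"
  unfolding alpha_def
proof (rule the_equality)
  have q: "q_seq \<in> int_seqs"
    by (simp add: int_seqs_def q_seq_def)
  then show "q_seq \<in> int_seqs \<and> is_alpha n_seq q_seq"
    using is_alpha_q_seq by blast
  fix b
  assume b: "b \<in> int_seqs \<and> is_alpha n_seq b"
  show "b = q_seq"
  \<comment> \<open>Extensionality fixes the value at 0, so agreement from index 1 on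
    suffices.\<close>
  proof (rule PiE_ext)
    show "b \<in> {1..} \<rightarrow>\<^sub>E UNIV" "q_seq \<in> {1..} \<rightarrow>\<^sub>E UNIV"
      using b q by (auto simp: int_seqs_def)
    fix m :: nat
    assume "m \<in> {1..}"
    \<comment> \<open>Every index \<open>m\<close> lies in some block, for instance the one of
      length \<open>2 ^ Suc m\<close>.\<close>
    moreover have "m \<le> 2 ^ Suc m"
      using less_exp[of "Suc m"] by simp
    ultimately show "b m = q_seq m"
      using is_alpha_n_seq_unique[of b m] b by simp
  qed
qed

end
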